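(* Let $(X,d)$ be a convergence-symmetric metric space. Then a sequence in $X$ is forward Cauchy if and only if it is backward Cauchy.
   Context: A metric on a non-empty set $X$ is a function $d:X\times X\to[0,\infty)$ with $d(x,y)=0$ iff $x=y$, and $d(x,z)\le d(x,y)+d(y,z)$ for all $x,y,z$; symmetry is NOT assumed. $(X,d)$ is convergence-symmetric if for any two sequences $(p_n),(q_n)$ in $X$, $d(p_n,q_n)\to0$ if and only if $d(q_n,p_n)\to0$. A sequence $(x_i)$ is forward Cauchy if for every $\epsilon>0$ there is $N$ with $d(x_i,x_{i+k})<\epsilon$ for all $i\ge N$ and $k\ge0$; it is backward Cauchy if for every $\epsilon>0$ there is $N$ with $d(x_{i+k},x_i)<\epsilon$ for all $i\ge N$ and $k\ge0$. *)

theory Defs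
  imports Complex_Main
begin

text \<open>Metrics here need not be symmetric, so the library's metric spaces do not apply.
  The distance is only constrained on the carrier \<open>X\<close>; its values off \<open>X\<close> are irrelevant.\<close>

definition asym_metric_on :: "'a set \<Rightarrow> ('a \<Rightarrow> 'a \<Rightarrow> real) \<Rightarrow> bool" where
  "asym_metric_on X d \<longleftrightarrow>
     X \<noteq> {} \<and>
     (\<forall>x\<in>X. \<forall>y\<in>X. 0 \<le> d x y) \<and>
     (\<forall>x\<in>X. \<forall>y\<in>X. d x y = 0 \<longleftrightarrow> x = y) \<and>
     (\<forall>x\<in>X. \<forall>y\<in>X. \<forall>z\<in>X. d x z \<le> d x y + d y z)"

definition convergence_symmetric_on :: "'a set \<Rightarrow> ('a \<Rightarrow> 'a \<Rightarrow> real) \<Rightarrow> bool" where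
  "convergence_symmetric_on X d \<longleftrightarrow>
     (\<forall>p q :: nat \<Rightarrow> 'a. range p \<subseteq> X \<longrightarrow> range q \<subseteq> X \<longrightarrow>
        ((\<lambda>n. d (p n) (q n)) \<longlonglongrightarrow> 0 \<longleftrightarrow> (\<lambda>n. d (q n) (p n)) \<longlonglongrightarrow> 0))"

definition forward_Cauchy :: "('a \<Rightarrow> 'a \<Rightarrow> real) \<Rightarrow> (nat \<Rightarrow> 'a) \<Rightarrow> bool" where
  "forward_Cauchy d x \<longleftrightarrow>
     (\<forall>\<epsilon>>0. \<exists>N. \<forall>i\<ge>N. \<forall>k\<ge>0. d (x i) (x (i + k)) < \<epsilon>)"

definition backward_Cauchy :: "('a \<Rightarrow> 'a \<Rightarrow> real) \<Rightarrow> (nat \<Rightarrow> 'a) \<Rightarrow> bool" where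
  "backward_Cauchy d x \<longleftrightarrow>
     (\<forall>\<epsilon>>0. \<exists>N. \<forall>i\<ge>N. \<forall>k\<ge>0. d (x (i + k)) (x i) < \<epsilon>)"

end

theory Submission
  imports Defs
begin

text \<open>If a forward Cauchy sequence \<open>x\<close> were not backward Cauchy, then some \<open>\<epsilon> > 0\<close> would admit
  pairs of indices \<open>i \<le> j\<close>, with \<open>i\<close> arbitrarily large, whose backward distance
  \<open>d (x j) (x i)\<close> is at least \<open>\<epsilon>\<close>. Picking one such pair beyond each \<open>n\<close> gives two sequences in
  the space whose forward distances tend to \<open>0\<close>, as \<open>x\<close> is forward Cauchy, while their backward
  distances stay away from \<open>0\<close>; convergence symmetry forbids this. The converse is the same
  statement for the reversed metric, since reversing \<open>d\<close> preserves the hypotheses and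
  exchanges the two Cauchy conditions.\<close>

lemma asym_metric_on_reverse:
  assumes "asym_metric_on X d"
  shows "asym_metric_on X (\<lambda>a b. d b a)"
  using assms unfolding asym_metric_on_def by (metis add.commute)

lemma convergence_symmetric_on_reverse:
  assumes "convergence_symmetric_on X d"
  shows "convergence_symmetric_on X (\<lambda>a b. d b a)"
  using assms unfolding convergence_symmetric_on_def by blast

lemma forward_Cauchy_reverse: "forward_Cauchy (\<lambda>a b. d b a) x \<longleftrightarrow> backward_Cauchy d x"
  unfolding forward_Cauchy_def backward_Cauchy_def ..

lemma backward_Cauchy_reverse: "backward_Cauchy (\<lambda>a b. d b a) x \<longleftrightarrow> forward_Cauchy d x"
  unfolding forward_Cauchy_def backward_Cauchy_def ..

lemma forward_Cauchy_imp_backward_Cauchy: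
  assumes metric: "asym_metric_on X d"
    and conv_sym: "convergence_symmetric_on X d"
    and in_X: "range x \<subseteq> X"
    and Cauchy: "forward_Cauchy d x"
  shows "backward_Cauchy d x"
proof (rule ccontr)
  assume "\<not> backward_Cauchy d x"
  then obtain \<epsilon> where "\<epsilon> > 0" and "\<forall>N. \<exists>i\<ge>N. \<exists>k. \<epsilon> \<le> d (x (i + k)) (x i)"
    unfolding backward_Cauchy_def by (metis not_le)
  then obtain i k where i_ge: "\<And>n. n \<le> i n"
    and far: "\<And>n. \<epsilon> \<le> d (x (i n + k n)) (x (i n))"
    by metis
  have "(\<lambda>n. d (x (i n)) (x (i n + k n))) \<longlonglongrightarrow> 0"
  proof (rule LIMSEQ_I)
    fix r :: real
    assume "r > 0"
    then obtain N where N: "\<And>m l. m \<ge> N \<Longrightarrow> d (x m) (x (m + l)) < r"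
      using Cauchy unfolding forward_Cauchy_def by blast
    have "norm (d (x (i n)) (x (i n + k n)) - 0) < r" if "n \<ge> N" for n
    proof -
      have "0 \<le> d (x (i n)) (x (i n + k n))"
        using metric in_X unfolding asym_metric_on_def by blast
      moreover have "d (x (i n)) (x (i n + k n)) < r"
        using N i_ge that order_trans by blast
      ultimately show ?thesis by simp
    qed
    then show "\<exists>N. \<forall>n\<ge>N. norm (d (x (i n)) (x (i n + k n)) - 0) < r" by blast
  qed
  moreover have "range (\<lambda>n. x (i n)) \<subseteq> X" "range (\<lambda>n. x (i n + k n)) \<subseteq> X"
    using in_X by auto
  ultimately have "(\<lambda>n. d (x (i n + k n)) (x (i n))) \<longlonglongrightarrow> 0"
    using conv_sym unfolding convergence_symmetric_on_def by blast
  then have "\<epsilon> \<le> 0"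
    using far by (intro LIMSEQ_le_const) auto
  with \<open>\<epsilon> > 0\<close> show False by simp
qed

theorem lemma4p3:
  fixes X :: "'a set" and d :: "'a \<Rightarrow> 'a \<Rightarrow> real" and x :: "nat \<Rightarrow> 'a"
  assumes "asym_metric_on X d"
    and "convergence_symmetric_on X d"
    and "range x \<subseteq> X"
  shows "forward_Cauchy d x \<longleftrightarrow> backward_Cauchy d x"
proof
  assume "forward_Cauchy d x"
  with assms show "backward_Cauchy d x"
    by (rule forward_Cauchy_imp_backward_Cauchy)
next
  assume "backward_Cauchy d x"
  then have "forward_Cauchy (\<lambda>a b. d b a) x"
    by (simp only: forward_Cauchy_reverse)
  with asym_metric_on_reverse[OF assms(1)] convergence_symmetric_on_reverse[OF assms(2)] assms(3)
  have "backward_Cauchy (\<lambda>a b. d b a) x"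
    by (rule forward_Cauchy_imp_backward_Cauchy)
  then show "forward_Cauchy d x"
    by (simp only: backward_Cauchy_reverse)
qed

end
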